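(* Let $\zeta\sim\mathcal{N}(0,I_\ell)$ and let $v_n=\min_\gamma J(\gamma;\zeta|A_n)$, where $A_n=\{x\in\mathbb{R}^\ell:\|x\|\le n^{c_4}\}$. Then $v_n\to J(\gamma_G;\zeta)$ as $n\to\infty$.
   Context: $c_4>0$ is a fixed universal constant. Fix $m,\ell_1,\dots,\ell_m\in\mathbb{N}$, $\ell=m+\sum_{i=1}^m\ell_i$, a symmetric positive definite $Q\in\mathbb{R}^{m\times m}$, and $W\in\mathbb{R}^{\ell\times\ell}$, partitioned by rows as $W=[S;H_1;\dots;H_m]$ with $S\in\mathbb{R}^{m\times\ell}$ and $H_i\in\mathbb{R}^{\ell_i\times\ell}$ of full row rank. The cost is $L(u,x)=\frac12u^\top Qu+u^\top Sx+\frac12x^\top S^\top Q^{-1}Sx$ for $u\in\mathbb{R}^m$, $x\in\mathbb{R}^\ell$. For $\gamma=(\gamma^1,\dots,\gamma^m)$ with each $\gamma^i:\mathbb{R}^{\ell_i}\to\mathbb{R}$ measurable, $$J(\gamma;\zeta)=\mathbb{E}\big[L(\gamma^1(H_1\zeta),\dots,\gamma^m(H_m\zeta),\zeta)\big],\quad J(\gamma;\zeta|A_n)=\mathbb{E}\big[\mathbb{I}_{\{\zeta\in A_n\}}L(\gamma^1(H_1\zeta),\dots,\gamma^m(H_m\zeta),\zeta)\big].$$ All minima are over such measurable $\gamma$. $\gamma_G$ is the minimizer of $J(\gamma;\zeta)$ (the Gaussian static team problem); it is known to be unique and linear. *)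

theory Defs
  imports "HOL-Probability.Probability" "Jordan_Normal_Form.DL_Rank"
begin

no_notation Finite_Cartesian_Product.vec_nth (infixl \<open>$\<close> 90)
hide_const (open) Finite_Cartesian_Product.vec Finite_Cartesian_Product.mat
  Finite_Cartesian_Product.transpose
no_notation Inner_Product.real_inner_class.inner (infixl \<open>\<bullet>\<close> 70)

text \<open>Vectors of \<open>\<real>\<^sup>k\<close> are elements of \<^term>\<open>carrier_vec k\<close>, with \<open>k\<close> a natural number.
  The coordinate map is a bijection onto the space of the product measure, so pulling the
  product \<open>\<sigma>\<close>-algebra back along it gives the Borel sets of \<open>\<real>\<^sup>k\<close>.\<close>

definition vec_borel :: "nat \<Rightarrow> real vec measure" where
  "vec_borel k = vimage_algebra (carrier_vec k) (\<lambda>x. \<lambda>j\<in>{..<k}. x $ j)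
     (Pi\<^sub>M {..<k} (\<lambda>_. borel))"

definition std_normal_vec :: "nat \<Rightarrow> real vec measure" where
  "std_normal_vec k = distr (Pi\<^sub>M {..<k} (\<lambda>_. density lborel std_normal_density))
     (vec_borel k) (vec k)"

lemma space_vec_borel [simp]: "space (vec_borel k) = carrier_vec k"
  by (simp add: vec_borel_def)

lemma vec_measurable:
  "vec k \<in> (Pi\<^sub>M {..<k} (\<lambda>_. density lborel std_normal_density)) \<rightarrow>\<^sub>M vec_borel k"
  unfolding vec_borel_def
proof (rule measurable_vimage_algebra2)
  have "(\<lambda>f. \<lambda>j\<in>{..<k}. f j) \<in> Pi\<^sub>M {..<k} (\<lambda>_. density lborel (\<lambda>x. ennreal (std_normal_density x)))
      \<rightarrow>\<^sub>M Pi\<^sub>M {..<k} (\<lambda>_. borel :: real measure)"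
    by (rule measurable_restrict) simp
  then show "(\<lambda>f. \<lambda>j\<in>{..<k}. vec k f $ j) \<in>
      Pi\<^sub>M {..<k} (\<lambda>_. density lborel (\<lambda>x. ennreal (std_normal_density x)))
      \<rightarrow>\<^sub>M Pi\<^sub>M {..<k} (\<lambda>_. borel)"
    by (simp cong: restrict_cong)
qed auto

definition total_dim :: "nat \<Rightarrow> (nat \<Rightarrow> nat) \<Rightarrow> nat" where
  "total_dim m ls = m + (\<Sum>i<m. ls i)"

definition S_block :: "nat \<Rightarrow> (nat \<Rightarrow> nat) \<Rightarrow> real mat \<Rightarrow> real mat" where
  "S_block m ls W = mat m (total_dim m ls) (\<lambda>(r, c). W $$ (r, c))"

text \<open>Players are numbered \<open>0, \<dots>, m - 1\<close>.\<close>

definition H_block :: "nat \<Rightarrow> (nat \<Rightarrow> nat) \<Rightarrow> real mat \<Rightarrow> nat \<Rightarrow> real mat" where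
  "H_block m ls W i =
     mat (ls i) (total_dim m ls) (\<lambda>(r, c). W $$ (m + (\<Sum>j<i. ls j) + r, c))"

definition positive_definite :: "nat \<Rightarrow> real mat \<Rightarrow> bool" where
  "positive_definite m Q \<longleftrightarrow>
     (\<forall>u\<in>carrier_vec m. u \<noteq> 0\<^sub>v m \<longrightarrow> u \<bullet> (Q *\<^sub>v u) > 0)"

definition full_row_rank :: "real mat \<Rightarrow> bool" where
  "full_row_rank A \<longleftrightarrow> vec_space.rank (dim_row A) A = dim_row A"

definition cost :: "real mat \<Rightarrow> real mat \<Rightarrow> real vec \<Rightarrow> real vec \<Rightarrow> real" where
  "cost Q S u x = 1/2 * (u \<bullet> (Q *\<^sub>v u)) + u \<bullet> (S *\<^sub>v x)
     + 1/2 * (x \<bullet> (S\<^sup>T *\<^sub>v (the (mat_inverse Q) *\<^sub>v (S *\<^sub>v x))))"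

definition policies :: "nat \<Rightarrow> (nat \<Rightarrow> nat) \<Rightarrow> (nat \<Rightarrow> real vec \<Rightarrow> real) set" where
  "policies m ls = {\<gamma>. \<forall>i<m. \<gamma> i \<in> borel_measurable (vec_borel (ls i))}"

definition action ::
  "nat \<Rightarrow> (nat \<Rightarrow> nat) \<Rightarrow> real mat \<Rightarrow> (nat \<Rightarrow> real vec \<Rightarrow> real) \<Rightarrow> real vec \<Rightarrow> real vec" where
  "action m ls W \<gamma> x = vec m (\<lambda>i. \<gamma> i (H_block m ls W i *\<^sub>v x))"

text \<open>The cost is nonnegative (lemma \<open>cost_nonneg\<close> below), so its expectation exists in
  \<open>[0, \<infinity>]\<close> for every measurable policy. It is taken as a nonnegative integral, because the
  Bochner integral would assign the value \<open>0\<close> to policies of infinite cost.\<close>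

definition J :: "'a measure \<Rightarrow> nat \<Rightarrow> (nat \<Rightarrow> nat) \<Rightarrow> real mat \<Rightarrow> real mat \<Rightarrow>
    ('a \<Rightarrow> real vec) \<Rightarrow> (nat \<Rightarrow> real vec \<Rightarrow> real) \<Rightarrow> ennreal" where
  "J M m ls Q W \<zeta> \<gamma> =
     (\<integral>\<^sup>+\<omega>. ennreal (cost Q (S_block m ls W) (action m ls W \<gamma> (\<zeta> \<omega>)) (\<zeta> \<omega>)) \<partial>M)"

definition J_on :: "'a measure \<Rightarrow> nat \<Rightarrow> (nat \<Rightarrow> nat) \<Rightarrow> real mat \<Rightarrow> real mat \<Rightarrow>
    ('a \<Rightarrow> real vec) \<Rightarrow> real vec set \<Rightarrow> (nat \<Rightarrow> real vec \<Rightarrow> real) \<Rightarrow> ennreal" where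
  "J_on M m ls Q W \<zeta> A \<gamma> =
     (\<integral>\<^sup>+\<omega>. ennreal (indicator A (\<zeta> \<omega>)
        * cost Q (S_block m ls W) (action m ls W \<gamma> (\<zeta> \<omega>)) (\<zeta> \<omega>)) \<partial>M)"

definition trunc_set :: "nat \<Rightarrow> real \<Rightarrow> nat \<Rightarrow> real vec set" where
  "trunc_set l c n = {x \<in> carrier_vec l. sqrt (x \<bullet> x) \<le> real n powr c}"

lemma positive_definite_inverse:
  assumes Q: "Q \<in> carrier_mat m m" and pd: "positive_definite m Q"
  obtains B where "mat_inverse Q = Some B" "B \<in> carrier_mat m m"
    "Q * B = 1\<^sub>m m" "B * Q = 1\<^sub>m m"
proof (cases "mat_inverse Q")
  case None
  have "det Q \<noteq> 0"
  proof
    assume "det Q = 0"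
    then obtain v where v: "v \<in> carrier_vec m" "v \<noteq> 0\<^sub>v m" "Q *\<^sub>v v = 0\<^sub>v m"
      using det_0_iff_vec_prod_zero_field[OF Q] by auto
    then show False
      using pd unfolding positive_definite_def by auto
  qed
  then have "Q \<in> Units (ring_mat TYPE(real) m m)"
    by (rule det_non_zero_imp_unit[OF Q])
  with mat_inverse(1)[OF Q None, of m] show ?thesis by simp
next
  case (Some B)
  with mat_inverse(2)[OF Q Some] show ?thesis using that by blast
qed

lemma cost_nonneg:
  assumes Q: "Q \<in> carrier_mat m m" and sym: "Q\<^sup>T = Q" and pd: "positive_definite m Q"
    and S: "S \<in> carrier_mat m l" and u: "u \<in> carrier_vec m" and x: "x \<in> carrier_vec l"
  shows "cost Q S u x \<ge> 0"
proof -
  obtain B where B: "mat_inverse Q = Some B" "B \<in> carrier_mat m m" "Q * B = 1\<^sub>m m"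
    using positive_definite_inverse[OF Q pd] by metis
  define s where "s = S *\<^sub>v x"
  define b where "b = B *\<^sub>v s"
  have s: "s \<in> carrier_vec m" and b: "b \<in> carrier_vec m"
    using S B x by (auto simp: s_def b_def)
  have Qb: "Q *\<^sub>v b = s"
    unfolding b_def using assoc_mult_mat_vec[OF Q B(2) s] B(3) s by simp
  have Qu: "Q *\<^sub>v u \<in> carrier_vec m" using Q u by auto
  have bQu: "b \<bullet> (Q *\<^sub>v u) = u \<bullet> s"
    using transpose_vec_mult_scalar[OF Q u b] sym Qb
    by (simp add: comm_scalar_prod[OF s u] comm_scalar_prod[OF b Qu])
  have xs: "x \<bullet> (S\<^sup>T *\<^sub>v b) = b \<bullet> s"
    using transpose_vec_mult_scalar[OF S x b] S b x
    by (simp add: s_def comm_scalar_prod[of x l])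
  have "(u + b) \<bullet> (Q *\<^sub>v (u + b)) = (u + b) \<bullet> (Q *\<^sub>v u + s)"
    using mult_add_distrib_mat_vec[OF Q u b] Qb by simp
  also have "\<dots> = u \<bullet> (Q *\<^sub>v u) + 2 * (u \<bullet> s) + b \<bullet> s"
    using u b s Qu bQu
    by (simp add: add_scalar_prod_distrib[of _ m] scalar_prod_add_distrib[of _ m])
  finally have "cost Q S u x = 1/2 * ((u + b) \<bullet> (Q *\<^sub>v (u + b)))"
    using B(1) xs by (simp add: cost_def s_def b_def algebra_simps)
  moreover have "(u + b) \<bullet> (Q *\<^sub>v (u + b)) \<ge> 0"
  proof (cases "u + b = 0\<^sub>v m")
    case True
    then show ?thesis using Q by (simp add: scalar_prod_def)
  next
    case False
    then show ?thesis using pd u b unfolding positive_definite_def by (simp add: less_imp_le)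
  qed
  ultimately show ?thesis by simp
qed

end

theory Submission
  imports Defs
begin

text \<open>
  Completing the square turns the cost into \<open>1/2 w\<^sup>T Q w\<close> with \<open>w = u + Q\<^sup>-\<^sup>1 S x\<close>
  (\<open>cost_eq_square\<close>): a policy is judged by its squared distance, in the norm of \<open>Q\<close>, to a target
  that does not depend on the policy. The policies form a vector space, so the parallelogram law
  makes nearly optimal policies close to each other in mean square (\<open>risk_parallelogram\<close>).

  Write \<open>opt A\<close> for the infimum of the cost restricted to the event \<open>A\<close>, and let the events \<open>A\<^sub>n\<close>
  increase. The numbers \<open>opt A\<^sub>n\<close> increase to some \<open>V\<close>, which may be taken finite. Along a
  subsequence on which \<open>V - opt A\<^sub>n\<close> is at most \<open>16\<^sup>-\<^sup>k\<close>, choose policies that are optimal on \<open>A\<^sub>n\<close>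
  up to \<open>16\<^sup>-\<^sup>k\<close>. Restricting the later of two consecutive policies to the earlier, smaller event
  does not increase its cost, which is about \<open>V\<close>. Hence both are nearly optimal there, and their
  mean square distance on this event is of order \<open>16\<^sup>-\<^sup>k\<close>. This rate makes the actions of each
  player converge almost everywhere on \<open>\<Union>A\<^sub>n\<close>. The pointwise limit of the policies of a player, as
  functions of that player's observation, is again a measurable policy, so the information
  constraint survives, and by Fatou's lemma its cost on \<open>\<Union>A\<^sub>n\<close> is at most \<open>V\<close>. This is
  \<open>opt_attained_along_incseq\<close>.

  Applied to a constant sequence it gives a minimizer for each truncated problem. Applied to the
  balls, whose union is the whole space, it gives convergence of \<open>opt A\<^sub>n\<close> to the optimal cost of the
  problem without truncation, which is the cost of \<open>\<gamma>\<^sub>G\<close>.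
\<close>

section \<open>Quadratic team problems restricted to growing events\<close>

definition quad_form :: "nat \<Rightarrow> (nat \<Rightarrow> nat \<Rightarrow> real) \<Rightarrow> (nat \<Rightarrow> real) \<Rightarrow> real" where
  "quad_form m Q w = (\<Sum>i<m. \<Sum>j<m. Q i j * w i * w j)"

lemma quad_form_parallelogram:
  "2 * quad_form m Q (\<lambda>i. (v i + w i) / 2) + quad_form m Q (\<lambda>i. v i - w i) / 2
    = quad_form m Q v + quad_form m Q w"
  unfolding quad_form_def sum_distrib_left sum_divide_distrib sum.distrib[symmetric]
  by (intro sum.cong refl) (simp add: field_simps)

lemma tendsto_quad_form:
  assumes "\<And>i. i < m \<Longrightarrow> (\<lambda>k. w k i) \<longlonglongrightarrow> w' i"
  shows "(\<lambda>k. quad_form m Q (w k)) \<longlonglongrightarrow> quad_form m Q w'"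
  unfolding quad_form_def using assms by (intro tendsto_intros) auto

lemma measurable_quad_form:
  assumes "\<And>i. i < m \<Longrightarrow> (\<lambda>x. w x i) \<in> borel_measurable M"
  shows "(\<lambda>x. quad_form m Q (w x)) \<in> borel_measurable M"
  unfolding quad_form_def using assms
  by (intro borel_measurable_sum borel_measurable_times borel_measurable_const) auto

lemma convergent_if_geometric_increments:
  fixes x :: "nat \<Rightarrow> real"
  assumes "\<And>k. k \<ge> k0 \<Longrightarrow> (x (Suc k) - x k)\<^sup>2 \<le> C / 4 ^ k"
  shows "convergent x"
proof -
  have "norm (x (Suc k) - x k) \<le> sqrt C * (1/2) ^ k" if "k \<ge> k0" for k
  proof -
    have "\<bar>x (Suc k) - x k\<bar> \<le> sqrt (C / 4 ^ k)"
      using assms[OF that] by (intro real_le_rsqrt) simp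
    also have "\<dots> = sqrt C * (1/2) ^ k"
      using real_sqrt_power[of 4 k] by (simp add: real_sqrt_divide power_divide)
    finally show ?thesis by simp
  qed
  moreover have "summable (\<lambda>k. sqrt C * (1/2) ^ k)"
    by (intro summable_mult summable_geometric) simp
  ultimately have "summable (\<lambda>k. x (Suc k) - x k)"
    by (intro summable_comparison_test[of "\<lambda>k. x (Suc k) - x k" "\<lambda>k. sqrt C * (1/2) ^ k"]) blast+
  then have "convergent (\<lambda>n. x n - x 0)"
    by (simp add: summable_iff_convergent sum_lessThan_telescope)
  then have "convergent (\<lambda>n. (x n - x 0) + x 0)"
    by (intro convergent_add convergent_const)
  then show ?thesis by simp
qed

text \<open>The matrices only matter through the observations \<open>h\<close>, the policy-independent offset \<open>b\<close> of
  the actions and a quadratic form, so the limit argument is carried out for arbitrary measurable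
  \<open>h\<close> and \<open>b\<close>. Coercivity is what lets convergence of the quadratic form of differences control the
  action of each player separately.\<close>

locale quadratic_team =
  fixes M :: "'a measure" and m :: nat and N :: "nat \<Rightarrow> 'b measure"
    and h :: "nat \<Rightarrow> 'a \<Rightarrow> 'b" and b :: "nat \<Rightarrow> 'a \<Rightarrow> real"
    and Q :: "nat \<Rightarrow> nat \<Rightarrow> real" and K :: "nat \<Rightarrow> real"
  assumes measurable_obs: "\<And>i. i < m \<Longrightarrow> h i \<in> M \<rightarrow>\<^sub>M N i"
    and measurable_offset: "\<And>i. i < m \<Longrightarrow> b i \<in> borel_measurable M"
    and quad_form_nonneg: "\<And>w. quad_form m Q w \<ge> 0"
    and bound_nonneg: "\<And>i. i < m \<Longrightarrow> K i \<ge> 0"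
    and coercive: "\<And>i w. i < m \<Longrightarrow> (w i)\<^sup>2 \<le> K i * quad_form m Q w"
begin

definition admissible :: "(nat \<Rightarrow> 'b \<Rightarrow> real) set" where
  "admissible = {\<gamma>. \<forall>i<m. \<gamma> i \<in> borel_measurable (N i)}"

definition loss :: "(nat \<Rightarrow> 'b \<Rightarrow> real) \<Rightarrow> 'a \<Rightarrow> real" where
  "loss \<gamma> \<omega> = quad_form m Q (\<lambda>i. \<gamma> i (h i \<omega>) + b i \<omega>)"

definition risk :: "'a set \<Rightarrow> (nat \<Rightarrow> 'b \<Rightarrow> real) \<Rightarrow> ennreal" where
  "risk A \<gamma> = (\<integral>\<^sup>+\<omega>. ennreal (indicator A \<omega> * loss \<gamma> \<omega>) \<partial>M)"

definition opt :: "'a set \<Rightarrow> ennreal" where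
  "opt A = (INF \<gamma>\<in>admissible. risk A \<gamma>)"

lemma loss_nonneg: "loss \<gamma> \<omega> \<ge> 0"
  by (simp add: loss_def quad_form_nonneg)

lemma admissible_nonempty: "admissible \<noteq> {}"
proof -
  have "(\<lambda>_ _. 0) \<in> admissible" by (simp add: admissible_def)
  then show ?thesis by blast
qed

lemma measurable_policy_obs:
  assumes "\<gamma> \<in> admissible" "i < m"
  shows "(\<lambda>\<omega>. \<gamma> i (h i \<omega>)) \<in> borel_measurable M"
  using measurable_compose[OF measurable_obs[OF assms(2)]] assms by (auto simp: admissible_def)

lemma measurable_loss [measurable]:
  assumes "\<gamma> \<in> admissible"
  shows "loss \<gamma> \<in> borel_measurable M"
  unfolding loss_def
  using measurable_policy_obs[OF assms] measurable_offset
  by (intro measurable_quad_form borel_measurable_add) auto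

lemma risk_mono: "A \<subseteq> B \<Longrightarrow> risk A \<gamma> \<le> risk B \<gamma>"
  unfolding risk_def
  by (intro nn_integral_mono ennreal_leI mult_right_mono loss_nonneg)
     (auto split: split_indicator)

lemma opt_le_risk: "\<gamma> \<in> admissible \<Longrightarrow> opt A \<le> risk A \<gamma>"
  unfolding opt_def by (rule INF_lower)

lemma opt_mono: "A \<subseteq> B \<Longrightarrow> opt A \<le> opt B"
  unfolding opt_def by (intro INF_mono) (use risk_mono in blast)

text \<open>The midpoint of two policies has the average of their two actions, because the offset \<open>b\<close> is the
  same for both, and it is itself a policy. So its cost is at least \<open>opt A\<close>, and the
  parallelogram law leaves the remainder as a bound on the distance. The additive form
  avoids subtraction of possibly infinite costs.\<close>

lemma risk_parallelogram:
  assumes A: "A \<in> sets M" and \<gamma>: "\<gamma> \<in> admissible" and \<delta>: "\<delta> \<in> admissible"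
  shows "2 * opt A
      + (\<integral>\<^sup>+\<omega>. ennreal (indicator A \<omega> * (quad_form m Q (\<lambda>i. \<gamma> i (h i \<omega>) - \<delta> i (h i \<omega>)) / 2)) \<partial>M)
    \<le> risk A \<gamma> + risk A \<delta>"
proof -
  define \<mu> where "\<mu> = (\<lambda>i y. (\<gamma> i y + \<delta> i y) / 2)"
  let ?D = "\<lambda>\<omega>. quad_form m Q (\<lambda>i. \<gamma> i (h i \<omega>) - \<delta> i (h i \<omega>))"
  have \<mu>: "\<mu> \<in> admissible"
    using \<gamma> \<delta> unfolding admissible_def \<mu>_def
    by (auto intro!: borel_measurable_divide borel_measurable_add borel_measurable_const)
  have D [measurable]: "?D \<in> borel_measurable M"
    using measurable_policy_obs[OF \<gamma>] measurable_policy_obs[OF \<delta>]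
    by (intro measurable_quad_form borel_measurable_diff) auto
  note [measurable] = A measurable_loss[OF \<gamma>] measurable_loss[OF \<delta>] measurable_loss[OF \<mu>]
  have eq: "2 * loss \<mu> \<omega> + ?D \<omega> / 2 = loss \<gamma> \<omega> + loss \<delta> \<omega>" for \<omega>
  proof -
    have "(\<lambda>i. \<mu> i (h i \<omega>) + b i \<omega>)
        = (\<lambda>i. ((\<gamma> i (h i \<omega>) + b i \<omega>) + (\<delta> i (h i \<omega>) + b i \<omega>)) / 2)"
      by (auto simp: \<mu>_def field_simps)
    then show ?thesis
      using quad_form_parallelogram[of m Q "\<lambda>i. \<gamma> i (h i \<omega>) + b i \<omega>" "\<lambda>i. \<delta> i (h i \<omega>) + b i \<omega>"]
      by (simp add: loss_def)
  qed
  have "2 * opt A + (\<integral>\<^sup>+\<omega>. ennreal (indicator A \<omega> * (?D \<omega> / 2)) \<partial>M)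
      \<le> 2 * risk A \<mu> + (\<integral>\<^sup>+\<omega>. ennreal (indicator A \<omega> * (?D \<omega> / 2)) \<partial>M)"
    by (intro add_right_mono mult_left_mono opt_le_risk \<mu>) simp
  also have "2 * risk A \<mu> + (\<integral>\<^sup>+\<omega>. ennreal (indicator A \<omega> * (?D \<omega> / 2)) \<partial>M)
      = (\<integral>\<^sup>+\<omega>. 2 * ennreal (indicator A \<omega> * loss \<mu> \<omega>) + ennreal (indicator A \<omega> * (?D \<omega> / 2)) \<partial>M)"
    unfolding risk_def by (subst nn_integral_add) (auto simp: nn_integral_cmult)
  also have "\<dots> = (\<integral>\<^sup>+\<omega>. ennreal (indicator A \<omega> * loss \<gamma> \<omega>) + ennreal (indicator A \<omega> * loss \<delta> \<omega>) \<partial>M)"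
  proof (intro nn_integral_cong)
    fix \<omega>
    show "2 * ennreal (indicator A \<omega> * loss \<mu> \<omega>) + ennreal (indicator A \<omega> * (?D \<omega> / 2))
       = ennreal (indicator A \<omega> * loss \<gamma> \<omega>) + ennreal (indicator A \<omega> * loss \<delta> \<omega>)"
      using eq[of \<omega>] loss_nonneg[of \<mu> \<omega>] loss_nonneg[of \<gamma> \<omega>] loss_nonneg[of \<delta> \<omega>]
        quad_form_nonneg[of "\<lambda>i. \<gamma> i (h i \<omega>) - \<delta> i (h i \<omega>)"]
      by (cases "\<omega> \<in> A") (simp_all flip: ennreal_plus ennreal_numeral ennreal_mult)
  qed
  also have "\<dots> = risk A \<gamma> + risk A \<delta>"
    unfolding risk_def by (subst nn_integral_add) auto
  finally show ?thesis .
qed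

text \<open>Existence of minimizers and convergence of optimal values are two cases of this
  statement. Its proof uses near-minimizers of the problems on \<open>A n\<close>, which exist by definition of
  the infimum, so that existence is not presupposed.\<close>

theorem opt_attained_along_incseq:
  assumes A: "range A \<subseteq> sets M" "incseq A"
  shows "\<exists>\<gamma>\<in>admissible. risk (\<Union>n. A n) \<gamma> \<le> (SUP n. opt (A n))"
proof (cases "(SUP n. opt (A n)) = \<infinity>")
  case True
  then show ?thesis using admissible_nonempty by (metis ex_in_conv infinity_ennreal_def top_greatest)
next
  case False
  define V where "V = (SUP n. opt (A n))"
  have V: "V \<noteq> \<infinity>" using False by (simp add: V_def)
  then have V_less: "V < \<infinity>" by (simp add: less_top)
  have optV: "opt (A n) \<le> V" for n
    unfolding V_def by (rule SUP_upper) simp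
  define \<epsilon> :: "nat \<Rightarrow> real" where "\<epsilon> k = (1/16) ^ k" for k
  have \<epsilon>: "\<epsilon> k > 0" for k by (simp add: \<epsilon>_def)
  have "\<exists>n. V < opt (A n) + ennreal (\<epsilon> k)" for k
    using SUP_approx_ennreal[OF \<epsilon>[of k], of UNIV V "\<lambda>n. opt (A n)"] V by (auto simp: V_def)
  then obtain n0 where n0: "\<And>k. V < opt (A (n0 k)) + ennreal (\<epsilon> k)" by metis
  \<comment> \<open>The indices \<open>n0 k\<close> need not increase; their partial sums do, and dominate them. The summand
    \<open>k\<close> makes them unbounded, so that the events \<open>A (n k)\<close> still exhaust the union.\<close>
  define n where "n k = k + (\<Sum>j\<le>k. n0 j)" for k
  have n_mono: "n k \<le> n (Suc k)" for k by (simp add: n_def)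
  have n_ge: "n0 k \<le> n k" for k
    unfolding n_def by (intro trans_le_add2 member_le_sum) auto
  define A' where "A' k = A (n k)" for k
  have A' [measurable]: "A' k \<in> sets M" for k using A by (auto simp: A'_def)
  have A'_mono: "A' k \<subseteq> A' (Suc k)" for k
    using incseqD[OF A(2) n_mono] by (simp add: A'_def)
  have V_le: "V \<le> opt (A' k) + ennreal (\<epsilon> k)" for k
  proof -
    have "opt (A (n0 k)) \<le> opt (A' k)"
      unfolding A'_def by (intro opt_mono incseqD[OF A(2) n_ge])
    then show ?thesis using n0[of k] by (meson add_right_mono le_less_trans less_imp_le less_le_trans)
  qed
  have "\<exists>\<gamma>\<in>admissible. risk (A' k) \<gamma> < opt (A' k) + ennreal (\<epsilon> k)" for k
  proof (rule INF_approx_ennreal[OF \<epsilon> opt_def])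
    show "opt (A' k) \<noteq> \<infinity>"
      using le_less_trans[OF optV[of "n k"] V_less] by (auto simp: A'_def)
  qed
  then obtain \<gamma> where \<gamma>: "\<And>k. \<gamma> k \<in> admissible"
    and risk_less: "\<And>k. risk (A' k) (\<gamma> k) < opt (A' k) + ennreal (\<epsilon> k)" by metis
  have risk_le: "risk (A' k) (\<gamma> k) \<le> V + ennreal (\<epsilon> k)" for k
    using less_imp_le[OF risk_less[of k]] add_right_mono[OF optV[of "n k"], of "ennreal (\<epsilon> k)"]
    unfolding A'_def by (rule order_trans)
  define D where "D k \<omega> = quad_form m Q (\<lambda>i. \<gamma> (Suc k) i (h i \<omega>) - \<gamma> k i (h i \<omega>))" for k \<omega>
  have D_nonneg: "D k \<omega> \<ge> 0" for k \<omega> by (simp add: D_def quad_form_nonneg)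
  have D_measurable [measurable]: "D k \<in> borel_measurable M" for k
    unfolding D_def using measurable_policy_obs[OF \<gamma>]
    by (intro measurable_quad_form borel_measurable_diff) auto
  have D_int: "(\<integral>\<^sup>+\<omega>. ennreal (indicator (A' k) \<omega> * (D k \<omega> / 2)) \<partial>M) \<le> 4 * ennreal (\<epsilon> k)"
    (is "?E \<le> _") for k
  proof -
    have eps: "ennreal (\<epsilon> (Suc k)) \<le> ennreal (\<epsilon> k)"
      by (intro ennreal_leI) (simp add: \<epsilon>_def)
    have "risk (A' k) (\<gamma> (Suc k)) \<le> risk (A' (Suc k)) (\<gamma> (Suc k))"
      by (intro risk_mono A'_mono)
    also have "\<dots> \<le> V + ennreal (\<epsilon> k)"
      using risk_le[of "Suc k"] add_left_mono[OF eps, of V] by (rule order_trans)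
    finally have 1: "risk (A' k) (\<gamma> (Suc k)) \<le> V + ennreal (\<epsilon> k)" .
    have "2 * V + ?E \<le> 2 * (opt (A' k) + ennreal (\<epsilon> k)) + ?E"
      by (intro add_right_mono mult_left_mono V_le) simp
    also have "\<dots> = (2 * opt (A' k) + ?E) + 2 * ennreal (\<epsilon> k)"
      by (simp add: algebra_simps)
    also have "\<dots> \<le> (risk (A' k) (\<gamma> (Suc k)) + risk (A' k) (\<gamma> k)) + 2 * ennreal (\<epsilon> k)"
      using risk_parallelogram[OF A' \<gamma> \<gamma>, of k "Suc k" k]
      by (intro add_right_mono) (simp add: D_def)
    also have "\<dots> \<le> ((V + ennreal (\<epsilon> k)) + (V + ennreal (\<epsilon> k))) + 2 * ennreal (\<epsilon> k)"
      by (intro add_mono 1 risk_le order_refl)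
    also have "\<dots> = 2 * V + (2 * ennreal (\<epsilon> k) + 2 * ennreal (\<epsilon> k))"
      by (simp only: mult_2) (simp only: ac_simps)
    also have "2 * ennreal (\<epsilon> k) + 2 * ennreal (\<epsilon> k) = 4 * ennreal (\<epsilon> k)"
      by (simp flip: distrib_right)
    finally show ?thesis
      using V by (subst (asm) ennreal_add_left_cancel_le) (auto simp: ennreal_mult_eq_top_iff)
  qed
  have conv: "AE \<omega> in M. \<omega> \<in> (\<Union>n. A n) \<longrightarrow> (\<forall>i<m. convergent (\<lambda>k. \<gamma> k i (h i \<omega>)))"
  proof -
    \<comment> \<open>The weight \<open>4 ^ k\<close> is a compromise: small enough against \<open>16 ^ k\<close> for the expectations to be
      summable, large enough to force geometric decay of the increments for almost every \<open>\<omega>\<close>.\<close>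
    let ?F = "\<lambda>k \<omega>. ennreal (4 ^ k * (indicator (A' k) \<omega> * (D k \<omega> / 2)))"
    have "(\<integral>\<^sup>+\<omega>. (\<Sum>k. ?F k \<omega>) \<partial>M) = (\<Sum>k. \<integral>\<^sup>+\<omega>. ?F k \<omega> \<partial>M)"
      by (intro nn_integral_suminf) measurable
    also have "\<dots> \<le> (\<Sum>k. ennreal (4 * (1/4) ^ k))"
    proof (intro suminf_le)
      fix k
      have "(\<integral>\<^sup>+\<omega>. ?F k \<omega> \<partial>M)
          = ennreal (4 ^ k) * (\<integral>\<^sup>+\<omega>. ennreal (indicator (A' k) \<omega> * (D k \<omega> / 2)) \<partial>M)"
        by (subst nn_integral_cmult[symmetric]) (auto simp: D_nonneg simp flip: ennreal_mult)
      also have "\<dots> \<le> ennreal (4 ^ k) * (4 * ennreal (\<epsilon> k))"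
        by (intro mult_left_mono D_int) simp
      also have "\<dots> = ennreal (4 ^ k * (4 * \<epsilon> k))"
        by (simp add: ennreal_mult \<epsilon>_def)
      also have "4 ^ k * (4 * \<epsilon> k) = 4 * (1/4) ^ k"
        by (simp add: \<epsilon>_def flip: power_mult_distrib)
      finally show "(\<integral>\<^sup>+\<omega>. ?F k \<omega> \<partial>M) \<le> ennreal (4 * (1/4) ^ k)" .
    qed auto
    also have "\<dots> < \<infinity>"
    proof -
      have "summable (\<lambda>k. 4 * (1/4 :: real) ^ k)"
        by (intro summable_mult summable_geometric) simp
      then show ?thesis
        by (subst suminf_ennreal2) auto
    qed
    finally have "AE \<omega> in M. (\<Sum>k. ?F k \<omega>) \<noteq> \<infinity>"
      by (intro nn_integral_PInf_AE) auto
    then show ?thesis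
    proof eventually_elim
      case (elim \<omega>)
      obtain C where C: "(\<Sum>k. ?F k \<omega>) = ennreal C" "C \<ge> 0"
        using elim by (cases "\<Sum>k. ?F k \<omega>") auto
      have F_le: "4 ^ k * (indicator (A' k) \<omega> * (D k \<omega> / 2)) \<le> C" for k
      proof -
        have "?F k \<omega> \<le> ennreal C"
          unfolding C(1)[symmetric] using sum_le_suminf[of "\<lambda>k. ?F k \<omega>" "{k}"] by simp
        then show ?thesis using C(2) by simp
      qed
      show ?case
      proof (intro impI allI)
        fix i assume i: "i < m" and "\<omega> \<in> (\<Union>n. A n)"
        then obtain k0 where k0: "\<omega> \<in> A k0" by auto
        show "convergent (\<lambda>k. \<gamma> k i (h i \<omega>))"
        proof (rule convergent_if_geometric_increments)
          fix k assume k: "k \<ge> k0"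
          have "k0 \<le> n k" using k by (simp add: n_def)
          then have "\<omega> \<in> A' k" using incseqD[OF A(2)] k0 by (auto simp: A'_def)
          then have Dk: "D k \<omega> \<le> 2 * C / 4 ^ k"
            using F_le[of k] by (simp add: field_simps)
          have "(\<gamma> (Suc k) i (h i \<omega>) - \<gamma> k i (h i \<omega>))\<^sup>2 \<le> K i * D k \<omega>"
            unfolding D_def by (rule coercive[OF i])
          also have "\<dots> \<le> K i * (2 * C / 4 ^ k)"
            by (intro mult_left_mono Dk bound_nonneg i)
          finally show "(\<gamma> (Suc k) i (h i \<omega>) - \<gamma> k i (h i \<omega>))\<^sup>2 \<le> K i * (2 * C) / 4 ^ k"
            by simp
        qed
      qed
    qed
  qed
  \<comment> \<open>The limit is taken on the observation space, so it is automatically a function of what player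
    \<open>i\<close> observes. Where the sequence diverges, \<open>lim\<close> has an unspecified value, which is met only on
    a null set of outcomes in the union.\<close>
  define \<gamma>' where "\<gamma>' i y = lim (\<lambda>k. \<gamma> k i y)" for i y
  have \<gamma>'_admissible: "\<gamma>' \<in> admissible"
    using \<gamma> unfolding admissible_def \<gamma>'_def by (auto intro!: borel_measurable_lim_metric)
  have "risk (\<Union>n. A n) \<gamma>' \<le> (\<integral>\<^sup>+\<omega>. liminf (\<lambda>k. ennreal (indicator (A' k) \<omega> * loss (\<gamma> k) \<omega>)) \<partial>M)"
    unfolding risk_def
  proof (rule nn_integral_mono_AE, use conv in eventually_elim)
    case (elim \<omega>)
    show ?case
    proof (cases "\<omega> \<in> (\<Union>n. A n)")
      case True
      then obtain k0 where k0: "\<omega> \<in> A k0" by auto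
      have "eventually (\<lambda>k. loss (\<gamma> k) \<omega> = indicator (A' k) \<omega> * loss (\<gamma> k) \<omega>) sequentially"
        using eventually_ge_at_top[of k0]
      proof eventually_elim
        case (elim k)
        then have "k0 \<le> n k" by (simp add: n_def)
        then have "\<omega> \<in> A' k" using incseqD[OF A(2)] k0 by (auto simp: A'_def)
        then show ?case by simp
      qed
      moreover have "(\<lambda>k. loss (\<gamma> k) \<omega>) \<longlonglongrightarrow> loss \<gamma>' \<omega>"
        unfolding loss_def \<gamma>'_def using elim True
        by (intro tendsto_quad_form tendsto_intros) (simp add: convergent_LIMSEQ_iff)
      ultimately have "(\<lambda>k. indicator (A' k) \<omega> * loss (\<gamma> k) \<omega>) \<longlonglongrightarrow> loss \<gamma>' \<omega>"
        by (rule Lim_transform_eventually[rotated])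
      then have "(\<lambda>k. ennreal (indicator (A' k) \<omega> * loss (\<gamma> k) \<omega>)) \<longlonglongrightarrow> ennreal (loss \<gamma>' \<omega>)"
        by (rule tendsto_ennrealI)
      then have "liminf (\<lambda>k. ennreal (indicator (A' k) \<omega> * loss (\<gamma> k) \<omega>)) = ennreal (loss \<gamma>' \<omega>)"
        by (intro lim_imp_Liminf) auto
      then show ?thesis using True by simp
    qed simp
  qed
  also have "\<dots> \<le> liminf (\<lambda>k. risk (A' k) (\<gamma> k))"
    unfolding risk_def using measurable_loss[OF \<gamma>] by (intro nn_integral_liminf) simp
  also have "\<dots> \<le> liminf (\<lambda>k. V + ennreal (\<epsilon> k))"
    by (intro Liminf_mono always_eventually allI risk_le)
  also have "\<dots> = V"
  proof (rule lim_imp_Liminf)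
    have "(\<lambda>k. ennreal (\<epsilon> k)) \<longlonglongrightarrow> ennreal 0"
      unfolding \<epsilon>_def by (intro tendsto_ennrealI LIMSEQ_power_zero) simp
    then have "(\<lambda>k. V + ennreal (\<epsilon> k)) \<longlonglongrightarrow> V + ennreal 0"
      by (rule tendsto_add[OF tendsto_const])
    then show "(\<lambda>k. V + ennreal (\<epsilon> k)) \<longlonglongrightarrow> V" by simp
  qed simp
  finally show ?thesis using \<gamma>'_admissible unfolding V_def by blast
qed

corollary minimizer_exists:
  assumes "A \<in> sets M"
  shows "\<exists>\<gamma>\<in>admissible. risk A \<gamma> = opt A"
proof -
  obtain \<gamma> where "\<gamma> \<in> admissible" "risk A \<gamma> \<le> opt A"
    using opt_attained_along_incseq[of "\<lambda>_. A"] assms by auto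
  then show ?thesis using opt_le_risk antisym by blast
qed

corollary opt_tendsto:
  assumes A: "range A \<subseteq> sets M" "incseq A"
  shows "(\<lambda>n. opt (A n)) \<longlonglongrightarrow> opt (\<Union>n. A n)"
proof -
  obtain \<gamma> where "\<gamma> \<in> admissible" "risk (\<Union>n. A n) \<gamma> \<le> (SUP n. opt (A n))"
    using opt_attained_along_incseq[OF A] by blast
  then have "opt (\<Union>n. A n) \<le> (SUP n. opt (A n))"
    using opt_le_risk order_trans by blast
  moreover have "(SUP n. opt (A n)) \<le> opt (\<Union>n. A n)"
    by (intro SUP_least opt_mono) auto
  ultimately have "opt (\<Union>n. A n) = (SUP n. opt (A n))" by (rule antisym)
  moreover have "(\<lambda>n. opt (A n)) \<longlonglongrightarrow> (SUP n. opt (A n))"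
    using A(2) by (intro LIMSEQ_SUP) (auto simp: mono_def intro!: opt_mono)
  ultimately show ?thesis by simp
qed

end

section \<open>Positive definite forms and completing the square\<close>

lemma scalar_prod_mult_mat_vec_eq_quad_form:
  assumes "Q \<in> carrier_mat m m" "w \<in> carrier_vec m"
  shows "w \<bullet> (Q *\<^sub>v w) = quad_form m (\<lambda>i j. Q $$ (i, j)) (\<lambda>i. w $ i)"
proof -
  have "w \<bullet> (Q *\<^sub>v w) = (\<Sum>i<m. w $ i * (\<Sum>j<m. Q $$ (i, j) * w $ j))"
    using assms by (simp add: scalar_prod_def lessThan_atLeast0)
  then show ?thesis by (simp add: quad_form_def sum_distrib_left mult_ac)
qed

text \<open>This is the Cauchy-Schwarz inequality for the form of \<open>Q\<close> applied to \<open>w\<close> and \<open>z = Q\<^sup>-\<^sup>1 e\<^sub>i\<close>, because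
  the form pairs \<open>w\<close> with \<open>z\<close> to \<open>w\<^sub>i\<close>. The constant is \<open>z\<^sub>i\<close>, the \<open>i\<close>-th diagonal entry of the inverse.\<close>

lemma coordinate_square_le:
  assumes Q: "Q \<in> carrier_mat m m" and sym: "Q\<^sup>T = Q" and pd: "positive_definite m Q"
    and i: "i < m"
  shows "\<exists>K\<ge>0. \<forall>w\<in>carrier_vec m. (w $ i)\<^sup>2 \<le> K * (w \<bullet> (Q *\<^sub>v w))"
proof -
  obtain B where B: "B \<in> carrier_mat m m" "Q * B = 1\<^sub>m m"
    using positive_definite_inverse[OF Q pd] by metis
  define z where "z = B *\<^sub>v unit_vec m i"
  have z: "z \<in> carrier_vec m" using B by (simp add: z_def)
  have Qz: "Q *\<^sub>v z = unit_vec m i"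
    unfolding z_def using assoc_mult_mat_vec[OF Q B(1), of "unit_vec m i"] B(2) by simp
  have "z \<noteq> 0\<^sub>v m"
  proof
    assume "z = 0\<^sub>v m"
    then have "unit_vec m i = (0\<^sub>v m :: real vec)" using Qz Q
      by (simp add: scalar_prod_def mult_mat_vec_def zero_vec_def)
    then have "unit_vec m i $ i = (0\<^sub>v m :: real vec) $ i" by (rule arg_cong)
    then show False using i by simp
  qed
  then have "z \<bullet> (Q *\<^sub>v z) > 0" using pd z by (simp add: positive_definite_def)
  then have zi: "z $ i > 0" using z i by (simp add: Qz)
  have "(w $ i)\<^sup>2 \<le> z $ i * (w \<bullet> (Q *\<^sub>v w))" if w: "w \<in> carrier_vec m" for w
  proof -
    \<comment> \<open>This \<open>t\<close> minimizes the form at \<open>w - t z\<close>; its nonnegativity there is the inequality.\<close>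
    define t where "t = w $ i / z $ i"
    define y where "y = w - t \<cdot>\<^sub>v z"
    have y: "y \<in> carrier_vec m" using w z by (simp add: y_def)
    have Qw: "Q *\<^sub>v w \<in> carrier_vec m" using Q w by simp
    have zQw: "z \<bullet> (Q *\<^sub>v w) = w $ i"
      using transpose_vec_mult_scalar[OF Q w z] sym Qz w i comm_scalar_prod[OF z Qw]
      by simp
    have "y \<bullet> (Q *\<^sub>v y) \<ge> 0"
      using pd y Q by (cases "y = 0\<^sub>v m") (auto simp: positive_definite_def less_imp_le scalar_prod_def)
    also have "Q *\<^sub>v y = Q *\<^sub>v w - t \<cdot>\<^sub>v unit_vec m i"
      unfolding y_def using Q w z Qz
      by (simp add: mult_minus_distrib_mat_vec[of _ m m] mult_mat_vec[of _ m m])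
    also have "y \<bullet> (Q *\<^sub>v w - t \<cdot>\<^sub>v unit_vec m i) = w \<bullet> (Q *\<^sub>v w) - t * w $ i - t * (w $ i - t * z $ i)"
      unfolding y_def using w z Qw zQw i
      by (simp add: minus_scalar_prod_distrib[of _ m] scalar_prod_minus_distrib[of _ m] algebra_simps)
    finally have "t * w $ i \<le> w \<bullet> (Q *\<^sub>v w)" using zi by (simp add: t_def)
    then show ?thesis using zi by (simp add: t_def field_simps power2_eq_square)
  qed
  then show ?thesis using zi less_imp_le by blast
qed

text \<open>The third term of the cost is exactly what completes the square, so no term remains
  outside it. The offset \<open>B S x\<close> is independent of the action \<open>u\<close>.\<close>

lemma cost_eq_square:
  assumes Q: "Q \<in> carrier_mat m m" and sym: "Q\<^sup>T = Q"
    and B: "mat_inverse Q = Some B" "B \<in> carrier_mat m m" "Q * B = 1\<^sub>m m"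
    and S: "S \<in> carrier_mat m l" and u: "u \<in> carrier_vec m" and x: "x \<in> carrier_vec l"
  shows "cost Q S u x
    = quad_form m (\<lambda>i j. Q $$ (i, j) / 2) (\<lambda>i. u $ i + (B *\<^sub>v (S *\<^sub>v x)) $ i)"
proof -
  define s where "s = S *\<^sub>v x"
  define b where "b = B *\<^sub>v s"
  have s: "s \<in> carrier_vec m" and b: "b \<in> carrier_vec m"
    using S B x by (auto simp: s_def b_def)
  have Qb: "Q *\<^sub>v b = s"
    unfolding b_def using assoc_mult_mat_vec[OF Q B(2) s] B(3) s by simp
  have Qu: "Q *\<^sub>v u \<in> carrier_vec m" using Q u by auto
  have bQu: "b \<bullet> (Q *\<^sub>v u) = u \<bullet> s"
    using transpose_vec_mult_scalar[OF Q u b] sym Qb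
    by (simp add: comm_scalar_prod[OF s u] comm_scalar_prod[OF b Qu])
  have xs: "x \<bullet> (S\<^sup>T *\<^sub>v b) = b \<bullet> s"
    using transpose_vec_mult_scalar[OF S x b] S b x
    by (simp add: s_def comm_scalar_prod[of x l])
  have "(u + b) \<bullet> (Q *\<^sub>v (u + b)) = (u + b) \<bullet> (Q *\<^sub>v u + s)"
    using mult_add_distrib_mat_vec[OF Q u b] Qb by simp
  also have "\<dots> = u \<bullet> (Q *\<^sub>v u) + 2 * (u \<bullet> s) + b \<bullet> s"
    using u b s Qu bQu
    by (simp add: add_scalar_prod_distrib[of _ m] scalar_prod_add_distrib[of _ m])
  finally have "cost Q S u x = (u + b) \<bullet> (Q *\<^sub>v (u + b)) / 2"
    using B(1) xs by (simp add: cost_def s_def b_def algebra_simps)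
  also have "\<dots> = quad_form m (\<lambda>i j. Q $$ (i, j)) (\<lambda>i. (u + b) $ i) / 2"
    using u b by (subst scalar_prod_mult_mat_vec_eq_quad_form[OF Q]) auto
  also have "\<dots> = quad_form m (\<lambda>i j. Q $$ (i, j) / 2) (\<lambda>i. u $ i + b $ i)"
    unfolding quad_form_def sum_divide_distrib using u b by (intro sum.cong refl) auto
  finally show ?thesis by (simp add: b_def s_def)
qed

section \<open>Measurability on vector spaces of variable dimension\<close>

lemma measurable_vec_index:
  assumes "j < k"
  shows "(\<lambda>x. x $ j) \<in> borel_measurable (vec_borel k)"
proof -
  have "(\<lambda>x. \<lambda>j\<in>{..<k}. x $ j) \<in> vec_borel k \<rightarrow>\<^sub>M Pi\<^sub>M {..<k} (\<lambda>_. borel :: real measure)"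
    unfolding vec_borel_def by (rule measurable_vimage_algebra1) (auto simp: space_PiM)
  from measurable_compose[OF this measurable_component_singleton[of j]] assms
  show ?thesis by simp
qed

lemma measurable_vec_borelI:
  assumes "\<And>x. x \<in> space M \<Longrightarrow> f x \<in> carrier_vec k"
    and "\<And>j. j < k \<Longrightarrow> (\<lambda>x. f x $ j) \<in> borel_measurable M"
  shows "f \<in> M \<rightarrow>\<^sub>M vec_borel k"
  unfolding vec_borel_def
  by (rule measurable_vimage_algebra2) (use assms in \<open>auto intro!: measurable_restrict\<close>)

lemma measurable_mult_mat_vec:
  assumes A: "A \<in> carrier_mat r k"
  shows "(\<lambda>x. A *\<^sub>v x) \<in> vec_borel k \<rightarrow>\<^sub>M vec_borel r"
proof (rule measurable_vec_borelI)
  fix i assume i: "i < r"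
  have "(\<lambda>x. \<Sum>j<k. A $$ (i, j) * x $ j) \<in> borel_measurable (vec_borel k)"
    by (intro borel_measurable_sum borel_measurable_times borel_measurable_const measurable_vec_index) simp
  then show "(\<lambda>x. (A *\<^sub>v x) $ i) \<in> borel_measurable (vec_borel k)"
    by (rule measurable_cong[THEN iffD1, rotated])
       (use A i in \<open>auto simp: scalar_prod_def lessThan_atLeast0 intro!: sum.cong\<close>)
qed (use A in auto)

lemma trunc_set_measurable: "trunc_set l c n \<in> sets (vec_borel l)"
proof -
  have "(\<lambda>x. sqrt (\<Sum>j<l. x $ j * x $ j)) \<in> borel_measurable (vec_borel l)"
    by (intro measurable_compose[OF _ borel_measurable_sqrt] borel_measurable_sum
        borel_measurable_times measurable_vec_index) simp_all
  then have "{x \<in> space (vec_borel l). sqrt (\<Sum>j<l. x $ j * x $ j) \<le> real n powr c} \<in> sets (vec_borel l)"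
    by measurable
  also have "{x \<in> space (vec_borel l). sqrt (\<Sum>j<l. x $ j * x $ j) \<le> real n powr c} = trunc_set l c n"
    by (auto simp: trunc_set_def scalar_prod_def lessThan_atLeast0)
  finally show ?thesis .
qed

lemma incseq_trunc_set: "c > 0 \<Longrightarrow> incseq (trunc_set l c)"
proof (rule incseq_SucI)
  fix n assume "c > 0"
  then have "real n powr c \<le> real (Suc n) powr c" by (intro powr_mono2) auto
  then show "trunc_set l c n \<subseteq> trunc_set l c (Suc n)" by (auto simp: trunc_set_def)
qed

lemma Union_trunc_set:
  assumes c: "c > 0"
  shows "(\<Union>n. trunc_set l c n) = carrier_vec l"
proof -
  have "\<exists>n. x \<in> trunc_set l c n" if x: "x \<in> carrier_vec l" for x
  proof -
    define t where "t = sqrt (x \<bullet> x)"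
    have t: "t \<ge> 0" by (simp add: t_def scalar_prod_def sum_nonneg)
    obtain n :: nat where n: "real n \<ge> t powr (1 / c)" using real_arch_simple by blast
    have "t = (t powr (1 / c)) powr c" using c t by (simp add: powr_powr)
    also have "\<dots> \<le> real n powr c" using c n by (intro powr_mono2) auto
    finally show ?thesis using x by (auto simp: trunc_set_def t_def)
  qed
  then show ?thesis by (auto simp: trunc_set_def)
qed

section \<open>Convergence of the truncated optimal values\<close>

theorem mainTheorem3:
  fixes M :: "'a measure" and m :: nat and ls :: "nat \<Rightarrow> nat" and Q W :: "real mat"
    and \<zeta> :: "'a \<Rightarrow> real vec" and c :: real and \<gamma>\<^sub>G :: "nat \<Rightarrow> real vec \<Rightarrow> real"
  assumes "c > 0"
    and "Q \<in> carrier_mat m m" and "Q\<^sup>T = Q" and "positive_definite m Q"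
    and "W \<in> carrier_mat (total_dim m ls) (total_dim m ls)"
    and "\<And>i. i < m \<Longrightarrow> full_row_rank (H_block m ls W i)"
    and "prob_space M"
    and "\<zeta> \<in> M \<rightarrow>\<^sub>M vec_borel (total_dim m ls)"
    and "distr M (vec_borel (total_dim m ls)) \<zeta> = std_normal_vec (total_dim m ls)"
    and "is_arg_min (J M m ls Q W \<zeta>) (\<lambda>\<gamma>. \<gamma> \<in> policies m ls) \<gamma>\<^sub>G"
  shows "(\<forall>n::nat. \<exists>\<gamma>. is_arg_min (J_on M m ls Q W \<zeta> (trunc_set (total_dim m ls) c n))
            (\<lambda>\<gamma>. \<gamma> \<in> policies m ls) \<gamma>) \<and>
         (\<lambda>n::nat. LEAST v. v \<in> J_on M m ls Q W \<zeta> (trunc_set (total_dim m ls) c n) ` policies m ls)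
           \<longlonglongrightarrow> J M m ls Q W \<zeta> \<gamma>\<^sub>G"
proof -
  note c = assms(1) and Q = assms(2) and sym = assms(3) and pd = assms(4)
    and \<zeta> = assms(8) and \<gamma>\<^sub>G = assms(10)
  define l where "l = total_dim m ls"
  define S where "S = S_block m ls W"
  have S: "S \<in> carrier_mat m l" by (simp add: S_def S_block_def l_def)
  have H: "H_block m ls W i \<in> carrier_mat (ls i) l" for i by (simp add: H_block_def l_def)
  note \<zeta> = \<zeta>[folded l_def]
  have \<zeta>_carrier: "\<zeta> \<omega> \<in> carrier_vec l" if "\<omega> \<in> space M" for \<omega>
    using measurable_space[OF \<zeta> that] by simp
  obtain B where B: "mat_inverse Q = Some B" "B \<in> carrier_mat m m" "Q * B = 1\<^sub>m m"
    using positive_definite_inverse[OF Q pd] by metis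
  define q where "q = (\<lambda>i j. Q $$ (i, j) / 2)"
  have q_eq: "quad_form m q w = vec m w \<bullet> (Q *\<^sub>v vec m w) / 2" for w
    by (subst scalar_prod_mult_mat_vec_eq_quad_form[OF Q])
       (auto simp: q_def quad_form_def sum_divide_distrib intro!: sum.cong)
  obtain K where K: "\<And>i. i < m \<Longrightarrow> K i \<ge> 0"
    "\<And>i w. i < m \<Longrightarrow> w \<in> carrier_vec m \<Longrightarrow> (w $ i)\<^sup>2 \<le> K i * (w \<bullet> (Q *\<^sub>v w))"
    using coordinate_square_le[OF Q sym pd] by metis
  define b where "b = (\<lambda>i \<omega>. (B *\<^sub>v (S *\<^sub>v \<zeta> \<omega>)) $ i)"
  define h where "h = (\<lambda>i \<omega>. H_block m ls W i *\<^sub>v \<zeta> \<omega>)"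
  interpret quadratic_team M m "\<lambda>i. vec_borel (ls i)" h b q "\<lambda>i. 2 * K i"
  proof
    fix i assume i: "i < m"
    show "h i \<in> M \<rightarrow>\<^sub>M vec_borel (ls i)"
      unfolding h_def by (rule measurable_compose[OF \<zeta> measurable_mult_mat_vec[OF H]])
    show "b i \<in> borel_measurable M"
      unfolding b_def
      using measurable_compose[OF measurable_compose[OF measurable_compose[OF \<zeta>
          measurable_mult_mat_vec[OF S]] measurable_mult_mat_vec[OF B(2)]] measurable_vec_index[OF i]] .
    show "0 \<le> 2 * K i" using K(1)[OF i] by simp
    show "(w i)\<^sup>2 \<le> 2 * K i * quad_form m q w" for w
      using K(2)[OF i, of "vec m w"] i by (simp add: q_eq)
  next
    show "0 \<le> quad_form m q w" for w
      using pd Q by (cases "vec m w = 0\<^sub>v m")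
        (auto simp: q_eq positive_definite_def less_imp_le scalar_prod_def)
  qed
  have admissible_eq: "admissible = policies m ls" by (simp add: admissible_def policies_def)
  have loss_eq: "cost Q S (action m ls W \<gamma> (\<zeta> \<omega>)) (\<zeta> \<omega>) = loss \<gamma> \<omega>"
    if "\<omega> \<in> space M" for \<gamma> \<omega>
    unfolding loss_def
    by (subst cost_eq_square[OF Q sym B S _ \<zeta>_carrier[OF that]])
       (auto simp: action_def quad_form_def q_def b_def h_def intro!: sum.cong)
  define A where "A n = \<zeta> -` trunc_set l c n \<inter> space M" for n
  have A: "range A \<subseteq> sets M"
    using measurable_sets[OF \<zeta> trunc_set_measurable] by (auto simp: A_def)
  have A_inc: "incseq A"
    using incseqD[OF incseq_trunc_set[OF c, of l]] unfolding incseq_def A_def by blast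
  have A_Un: "(\<Union>n. A n) = space M"
    using Union_trunc_set[OF c, of l] \<zeta>_carrier by (fastforce simp: A_def)
  have J_on_eq: "J_on M m ls Q W \<zeta> (trunc_set l c n) = risk (A n)" for n
    unfolding J_on_def risk_def A_def S_def[symmetric]
    by (auto simp: loss_eq indicator_def intro!: ext nn_integral_cong)
  have J_eq: "J M m ls Q W \<zeta> = risk (space M)"
    unfolding J_def risk_def S_def[symmetric]
    by (auto simp: loss_eq intro!: ext nn_integral_cong)
  have arg_min: "is_arg_min (risk E) (\<lambda>\<gamma>. \<gamma> \<in> policies m ls) \<gamma>
      \<longleftrightarrow> \<gamma> \<in> admissible \<and> risk E \<gamma> = opt E" if "E \<in> sets M" for E \<gamma>
    using minimizer_exists[OF that] opt_le_risk[of _ E]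
    unfolding is_arg_min_def admissible_eq by (metis leD order_le_imp_less_or_eq)
  have A_sets: "A n \<in> sets M" for n using A by blast
  have "(LEAST v. v \<in> risk (A n) ` admissible) = opt (A n)" for n
    using minimizer_exists[OF A_sets[of n]] opt_le_risk[of _ "A n"]
    by (intro Least_equality) (auto intro: rev_image_eqI)
  moreover have "(\<lambda>n. opt (A n)) \<longlonglongrightarrow> risk (space M) \<gamma>\<^sub>G"
    using opt_tendsto[OF A A_inc] \<gamma>\<^sub>G arg_min[OF sets.top] by (simp add: A_Un J_eq)
  moreover have "\<exists>\<gamma>. is_arg_min (risk (A n)) (\<lambda>\<gamma>. \<gamma> \<in> policies m ls) \<gamma>" for n
    using minimizer_exists[OF A_sets[of n]] arg_min[OF A_sets[of n]] by blast
  ultimately show ?thesis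
    unfolding l_def[symmetric] J_on_eq J_eq admissible_eq by simp
qed

end
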